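(* Let $G(n,p)$ denote the set of all simple graphs on $n$ vertices where each edge is chosen independently with probability $p$, and let $P(G(n,p))$ be the probability of a graph from $G(n,p)$ having diameter $2$. Then $$P(G(n,p))\geq 1-\frac{n^2(1-p^2)^{n-2}(1-p)}{2}$$ and $$P(G(n,p))\leq\frac{2}{(n-1)^2(1-p^2)^n(1-p)}+\frac{8}{n}\left(1+\frac{p^3}{(1-p)^2}\right)^n.$$
   Context: The diameter of a graph $G$ is the maximum number of edges in $G$ that are needed to traverse from one vertex to another in $G$, where paths that backtrack, detour, or loop are excluded (that is, the maximum graph distance between two vertices).
   Formalization: "Having diameter 2" is taken as "diameter at most 2", so the complete graph counts: with diameter exactly 2 the lower bound fails (n = 2, p = 0.9: probability 0, bound 0.8). Also n ≥ 2, and p < 1 for the upper bound, where the formulas are defined. *)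

theory Defs
  imports
    "HOL-Probability.Product_PMF"
    "Graph_Theory.Pair_Digraph"
    "Graph_Theory.Shortest_Path"
begin

text \<open>
  A simple graph is a \<^locale>\<open>pair_graph\<close>: a finite loop-free digraph with a symmetric arc
  set, so that an undirected edge \<open>{u, v}\<close> is represented by the two arcs \<open>(u, v)\<close> and \<open>(v, u)\<close>.
\<close>

definition vertex_pairs :: "nat \<Rightarrow> nat set set" where
  "vertex_pairs n = {e. e \<subseteq> {..<n} \<and> card e = 2}"

definition graph_of_edges :: "nat \<Rightarrow> nat set set \<Rightarrow> nat pair_pre_digraph" where
  "graph_of_edges n E = \<lparr>pverts = {..<n}, parcs = {(u, v). {u, v} \<in> E}\<rparr>"

definition random_graph :: "nat \<Rightarrow> real \<Rightarrow> nat pair_pre_digraph pmf" where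
  "random_graph n p =
     map_pmf (\<lambda>x. graph_of_edges n {e. x e})
       (Pi_pmf (vertex_pairs n) False (\<lambda>_. bernoulli_pmf p))"

lemma random_graph_simple:
  assumes "G \<in> set_pmf (random_graph n p)"
  shows "pair_graph G" and "pverts G = {..<n}"
proof -
  obtain x where x: "x \<in> set_pmf (Pi_pmf (vertex_pairs n) False (\<lambda>_. bernoulli_pmf p))"
    and G: "G = graph_of_edges n {e. x e}"
    using assms by (auto simp: random_graph_def)
  have fin: "finite (vertex_pairs n)"
    by (rule finite_subset[of _ "Pow {..<n}"]) (auto simp: vertex_pairs_def)
  have E: "e \<in> vertex_pairs n" if "x e" for e
    using x that set_Pi_pmf_subset[OF fin, of False "\<lambda>_. bernoulli_pmf p"] by auto
  have arc: "u < n \<and> v < n \<and> u \<noteq> v" if "x {u, v}" for u v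
    using E[OF that] by (cases "u = v") (auto simp: vertex_pairs_def)
  have "finite {(u, v). x {u, v}}"
    by (rule finite_subset[of _ "{..<n} \<times> {..<n}"]) (auto dest: arc)
  then show "pair_graph G"
    unfolding G graph_of_edges_def
    by unfold_locales
      (auto dest: arc intro!: symI simp: insert_commute symmetric_def arcs_ends_def arc_to_ends_def)
  show "pverts G = {..<n}"
    by (simp add: G graph_of_edges_def)
qed

text \<open>
  The distance \<open>\<mu>\<close> for unit arc costs is the least number of arcs of a walk from \<open>u\<close> to \<open>v\<close>, and
  \<open>\<infinity>\<close> if there is no such walk; in particular, a disconnected graph has diameter \<open>\<infinity>\<close>.
\<close>

definition graph_diameter :: "('a, 'b) pre_digraph \<Rightarrow> ereal" where
  "graph_diameter G = (SUP u\<in>verts G. SUP v\<in>verts G. wf_digraph.\<mu> G (\<lambda>_. 1) u v)"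

text \<open>
  ``Diameter 2'' means that any two vertices are joined by a path of at most two edges, so the
  complete graph, of diameter 1, is included. With diameter exactly 2 the lower bound would fail
  for \<open>p\<close> near 1: for \<open>n = 2\<close> no graph has diameter exactly 2, but the bound is \<open>2 * p - 1\<close>.
\<close>

definition prob_diameter_at_most_two :: "nat \<Rightarrow> real \<Rightarrow> real" where
  "prob_diameter_at_most_two n p =
     measure_pmf.prob (random_graph n p) {G. graph_diameter (with_proj G) \<le> 2}"

end

theory Submission
  imports Defs
begin

text \<open>
  Call a pair of vertices bad if it is joined neither by an edge nor by a path of two edges. The
  diameter is at most 2 iff there is no bad pair. A given pair is bad with probability
  \<open>q = (1 - p) * (1 - p\<^sup>2) ^ (n - 2)\<close>, so the lower bound is the union bound over the
  \<open>n * (n - 1) / 2\<close> pairs.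

  The upper bound is the second moment method for the number \<open>X\<close> of bad pairs:
  \<open>P (X = 0) \<le> E (X\<^sup>2) / (E X)\<^sup>2 - 1\<close>. The diagonal terms of \<open>E (X\<^sup>2)\<close> contribute \<open>1 / E X\<close>, which
  is at most the first term of the bound. With \<open>t = p ^ 3 / (1 - p)\<^sup>2\<close>, two pairs that share a vertex are both bad with
  probability at most \<open>q\<^sup>2 * (1 + t) ^ n / (1 - p\<^sup>2)\<^sup>2\<close>, and two disjoint pairs with probability at
  most \<open>q\<^sup>2 * (1 + 4 * t / (1 + p) ^ 3)\<close>; for \<open>p \<le> 2 / 5\<close> and \<open>n \<ge> 4\<close> these two contributions sum to
  at most \<open>8 / n * (1 + t) ^ n\<close>. For \<open>p \<ge> 2 / 5\<close> or \<open>n \<le> 8\<close> that expression is at least 1.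
\<close>

section \<open>Products of Bernoulli distributions\<close>

text \<open>Plays the part of measurability with respect to the coordinates in \<open>S\<close>.
  Since \<open>S\<close> may be larger than necessary, independence reduces to exhibiting disjoint
  sets of coordinates.\<close>

definition determined_by :: "'a set \<Rightarrow> (('a \<Rightarrow> bool) \<Rightarrow> bool) \<Rightarrow> bool" where
  "determined_by S P \<longleftrightarrow> (\<forall>x y. (\<forall>e\<in>S. x e = y e) \<longrightarrow> P x = P y)"

lemma determined_by_upd:
  assumes "determined_by (insert e S) P"
  shows "determined_by S (\<lambda>x. P (x(e := b)))"
  unfolding determined_by_def
proof (intro allI impI)
  fix x y :: "'a \<Rightarrow> bool"
  assume "\<forall>f\<in>S. x f = y f"
  then have "\<forall>f\<in>insert e S. (x(e := b)) f = (y(e := b)) f"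
    by simp
  then show "P (x(e := b)) = P (y(e := b))"
    using assms unfolding determined_by_def by blast
qed

lemma determined_by_upd_outside:
  assumes "determined_by S P" and "e \<notin> S"
  shows "P (x(e := b)) = P x"
proof -
  have "\<forall>f\<in>S. (x(e := b)) f = x f"
    using assms(2) by auto
  then show ?thesis
    using assms(1) unfolding determined_by_def by blast
qed

lemma determined_by_Ball:
  assumes "\<And>i. i \<in> I \<Longrightarrow> determined_by (S i) (P i)"
  shows "determined_by (\<Union>i\<in>I. S i) (\<lambda>x. \<forall>i\<in>I. P i x)"
  unfolding determined_by_def
proof (intro allI impI)
  fix x y :: "'b \<Rightarrow> bool"
  assume "\<forall>e\<in>\<Union>i\<in>I. S i. x e = y e"
  then have "P i x = P i y" if "i \<in> I" for i
    using assms[OF that] that unfolding determined_by_def by blast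
  then show "(\<forall>i\<in>I. P i x) = (\<forall>i\<in>I. P i y)"
    by blast
qed

locale bernoulli_product =
  fixes A :: "'a set" and p :: real
  assumes finite_A: "finite A" and p_nonneg: "0 \<le> p" and p_le_1: "p \<le> 1"
begin

definition pr :: "(('a \<Rightarrow> bool) \<Rightarrow> bool) \<Rightarrow> real" where
  "pr P = measure_pmf.prob (Pi_pmf A False (\<lambda>_. bernoulli_pmf p)) {x. P x}"

lemma pr_True [simp]: "pr (\<lambda>_. True) = 1"
  by (simp add: pr_def)

lemma pr_False [simp]: "pr (\<lambda>_. False) = 0"
  by (simp add: pr_def)

lemma pr_conv_pmf: "pr P = pmf (map_pmf P (Pi_pmf A False (\<lambda>_. bernoulli_pmf p))) True"
  by (simp add: pr_def pmf_map vimage_def)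

text \<open>Total probability, conditioning on the coordinate \<open>e\<close>. The conditioned
  events are written as substitutions, so they stay events of the same product space and
  conditioning can be iterated.\<close>

lemma pr_split:
  assumes "e \<in> A"
  shows "pr P = p * pr (\<lambda>x. P (x(e := True))) + (1 - p) * pr (\<lambda>x. P (x(e := False)))"
proof -
  define \<mu> where "\<mu> = Pi_pmf (A - {e}) False (\<lambda>_. bernoulli_pmf p)"
  \<comment> \<open>Stated for every \<open>Q\<close>, as it is applied to \<open>P\<close> and to
    both substituted events; for the latter a second update at \<open>e\<close> overrides the first,
    and the weights \<open>p\<close> and \<open>1 - p\<close> add up to 1.\<close>
  have *: "pr Q = p * measure_pmf.prob \<mu> {x. Q (x(e := True))}
      + (1 - p) * measure_pmf.prob \<mu> {x. Q (x(e := False))}" for Q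
  proof -
    have "Pi_pmf A False (\<lambda>_. bernoulli_pmf p) =
        bind_pmf (bernoulli_pmf p) (\<lambda>b. map_pmf (\<lambda>x. x(e := b)) \<mu>)"
      using Pi_pmf_insert'[of "A - {e}" e False "\<lambda>_. bernoulli_pmf p"] finite_A assms
      by (simp add: insert_absorb \<mu>_def map_pmf_def)
    then show ?thesis
      using p_nonneg p_le_1
      by (simp add: pr_conv_pmf map_bind_pmf pmf_bind pmf.map_comp o_def mult.commute)
        (simp add: pmf_map vimage_def)
  qed
  show ?thesis
    by (simp add: *[of P] *[of "\<lambda>x. P (x(e := True))"] *[of "\<lambda>x. P (x(e := False))"] algebra_simps)
qed

text \<open>Conditioning on the coordinates of \<open>S\<close> one by one never affects
  \<open>Q\<close>, and both sides split in the same way; once no coordinate is left,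
  \<open>P\<close> is constant.\<close>

lemma pr_conj_indep:
  assumes "S \<subseteq> A" and "determined_by S P" and "determined_by T Q" and "S \<inter> T = {}"
  shows "pr (\<lambda>x. P x \<and> Q x) = pr P * pr Q"
proof -
  have "finite S"
    using assms(1) finite_A finite_subset by blast
  then show ?thesis
    using assms(1,2,4)
  proof (induction S arbitrary: P rule: finite_induct)
    case empty
    then have "P = (\<lambda>_. True) \<or> P = (\<lambda>_. False)"
      unfolding determined_by_def by (metis empty_iff)
    then show ?case by auto
  next
    case (insert e S)
    have Q: "Q (x(e := b)) = Q x" for x b
      using insert.prems(3) by (intro determined_by_upd_outside[OF assms(3)]) auto
    have IH: "pr (\<lambda>x. P (x(e := b)) \<and> Q x) = pr (\<lambda>x. P (x(e := b))) * pr Q" for b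
      using insert.prems by (intro insert.IH determined_by_upd) auto
    have "e \<in> A"
      using insert.prems(1) by simp
    show ?case
      by (subst (1 2) pr_split[OF \<open>e \<in> A\<close>]) (simp add: Q IH algebra_simps)
  qed
qed

lemma pr_Ball_indep:
  assumes "finite I" and "\<And>i. i \<in> I \<Longrightarrow> S i \<subseteq> A"
    and "\<And>i. i \<in> I \<Longrightarrow> determined_by (S i) (P i)"
    and "\<And>i j. i \<in> I \<Longrightarrow> j \<in> I \<Longrightarrow> i \<noteq> j \<Longrightarrow> S i \<inter> S j = {}"
    and "\<And>i. i \<in> I \<Longrightarrow> pr (P i) = c"
  shows "pr (\<lambda>x. \<forall>i\<in>I. P i x) = c ^ card I"
  using assms
proof (induction I rule: finite_induct)
  case (insert i I)
  have "pr (\<lambda>x. P i x \<and> (\<forall>j\<in>I. P j x)) = pr (P i) * pr (\<lambda>x. \<forall>j\<in>I. P j x)"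
  proof (rule pr_conj_indep)
    show "determined_by (\<Union>j\<in>I. S j) (\<lambda>x. \<forall>j\<in>I. P j x)"
      using insert.prems(2) by (intro determined_by_Ball) auto
    have "S i \<inter> S j = {}" if "j \<in> I" for j
      using insert.prems(3)[of i j] insert.hyps(2) that by auto
    then show "S i \<inter> (\<Union>j\<in>I. S j) = {}"
      by blast
  qed (use insert.prems in auto)
  moreover have "pr (\<lambda>x. \<forall>j\<in>I. P j x) = c ^ card I"
    using insert.prems by (intro insert.IH) auto
  ultimately show ?case
    using insert.hyps insert.prems(4)[of i] by simp
qed simp

text \<open>For the number \<open>X\<close> of events that occur, with mean \<open>m\<close>, the
  indicator of \<open>X = 0\<close> times the square of \<open>m\<close> is pointwise at most the
  square of \<open>X - m\<close>; taking expectations bounds it by the variance. Keeping the factor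
  on the left avoids a division by zero.\<close>

lemma second_moment_bound:
  fixes B :: "'i \<Rightarrow> ('a \<Rightarrow> bool) \<Rightarrow> bool"
  assumes "finite I"
  defines "m \<equiv> \<Sum>i\<in>I. pr (B i)"
  shows "pr (\<lambda>x. \<forall>i\<in>I. \<not> B i x) * m\<^sup>2 \<le> (\<Sum>i\<in>I. \<Sum>j\<in>I. pr (\<lambda>x. B i x \<and> B j x)) - m\<^sup>2"
proof -
  define \<mu> where "\<mu> = Pi_pmf A False (\<lambda>_. bernoulli_pmf p)"
  have int [simp]: "integrable (measure_pmf \<mu>) f" for f :: "_ \<Rightarrow> real"
  proof (rule integrable_measure_pmf_finite)
    \<comment> \<open>The default value False outside \<open>A\<close> means that an outcome is the
      indicator of a subset of \<open>A\<close>, so the support is finite.\<close>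
    have "x = (\<lambda>e. e \<in> {e. x e}) \<and> {e. x e} \<subseteq> A" if "x \<in> set_pmf \<mu>" for x
      using that set_Pi_pmf_subset[OF finite_A, of False "\<lambda>_. bernoulli_pmf p"]
      by (auto simp: \<mu>_def)
    then have "set_pmf \<mu> \<subseteq> (\<lambda>S e. e \<in> S) ` Pow A"
      by blast
    then show "finite (set_pmf \<mu>)"
      using finite_A by (simp add: finite_subset)
  qed
  have pr: "pr P = measure_pmf.expectation \<mu> (\<lambda>x. of_bool (P x))" for P
  proof -
    have "of_bool (P x) = (indicator {x. P x} x :: real)" for x
      by (simp add: indicator_def)
    then show ?thesis
      by (simp add: pr_def \<mu>_def)
  qed
  define X :: "('a \<Rightarrow> bool) \<Rightarrow> real" where "X x = (\<Sum>i\<in>I. of_bool (B i x))" for x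
  have m: "measure_pmf.expectation \<mu> X = m"
    by (simp add: X_def[abs_def] m_def pr)
  have "measure_pmf.expectation \<mu> (\<lambda>x. of_bool (\<forall>i\<in>I. \<not> B i x) * m\<^sup>2)
      \<le> measure_pmf.expectation \<mu> (\<lambda>x. (X x * X x) - 2 * m * X x + m\<^sup>2)"
  proof (rule integral_mono)
    fix x
    show "of_bool (\<forall>i\<in>I. \<not> B i x) * m\<^sup>2 \<le> X x * X x - 2 * m * X x + m\<^sup>2"
    proof (cases "\<forall>i\<in>I. \<not> B i x")
      case True
      then show ?thesis by (simp add: X_def)
    next
      case False
      have "0 \<le> (X x - m)\<^sup>2" by simp
      also have "\<dots> = X x * X x - 2 * m * X x + m\<^sup>2"
        by (simp add: power2_eq_square algebra_simps)
      finally have "0 \<le> X x * X x - 2 * m * X x + m\<^sup>2" .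
      moreover have "of_bool (\<forall>i\<in>I. \<not> B i x) = (0 :: real)"
        using False by simp
      ultimately show ?thesis
        by (simp only: mult_zero_left)
    qed
  qed simp_all
  also have "\<dots> = measure_pmf.expectation \<mu> (\<lambda>x. X x * X x) - m\<^sup>2"
    by (simp add: m power2_eq_square)
  also have "measure_pmf.expectation \<mu> (\<lambda>x. X x * X x)
      = (\<Sum>i\<in>I. \<Sum>j\<in>I. pr (\<lambda>x. B i x \<and> B j x))"
    by (simp add: X_def sum_product pr of_bool_conj)
  finally show ?thesis
    by (simp add: pr)
qed

section \<open>Probabilities of small patterns of mutually exclusive edges\<close>

lemma pr_not:
  assumes "e \<in> A"
  shows "pr (\<lambda>x. \<not> x e) = 1 - p"
  by (subst pr_split[OF assms]) simp

lemma pr_not_not: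
  assumes "e \<in> A" "f \<in> A" "e \<noteq> f"
  shows "pr (\<lambda>x. \<not> x e \<and> \<not> x f) = (1 - p)\<^sup>2"
  by (subst pr_split[OF assms(1)]) (use assms in \<open>simp add: pr_not power2_eq_square\<close>)

lemma pr_nand:
  assumes "e \<in> A" "f \<in> A" "e \<noteq> f"
  shows "pr (\<lambda>x. \<not> (x e \<and> x f)) = 1 - p\<^sup>2"
  by (subst pr_split[OF assms(1)]) (use assms in \<open>simp add: pr_not power2_eq_square algebra_simps\<close>)

text \<open>The exclusions form a path with \<open>e\<close> in the middle. If \<open>e\<close> is
  present, both others must be absent; if not, they are free:
  \<open>p * (1 - p)\<^sup>2 + (1 - p)\<close>.\<close>

lemma pr_nand_path:
  assumes "e \<in> A" "f \<in> A" "g \<in> A" "distinct [e, f, g]"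
  shows "pr (\<lambda>x. \<not> (x e \<and> x f) \<and> \<not> (x e \<and> x g)) = 1 - 2 * p\<^sup>2 + p ^ 3"
proof -
  have "f \<noteq> e" "g \<noteq> e"
    using assms by auto
  then show ?thesis
    by (subst pr_split[OF assms(1)])
      (use assms in \<open>simp add: pr_not_not power2_eq_square power3_eq_cube algebra_simps\<close>)
qed

lemma pr_nand_nand:
  assumes "e \<in> A" "f \<in> A" "g \<in> A" "h \<in> A" "distinct [e, f, g, h]"
  shows "pr (\<lambda>x. \<not> (x e \<and> x f) \<and> \<not> (x g \<and> x h)) = (1 - p\<^sup>2)\<^sup>2"
proof -
  have "pr (\<lambda>x. \<not> (x e \<and> x f) \<and> \<not> (x g \<and> x h)) =
      pr (\<lambda>x. \<not> (x e \<and> x f)) * pr (\<lambda>x. \<not> (x g \<and> x h))"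
    by (rule pr_conj_indep[where S = "{e, f}" and T = "{g, h}"])
      (use assms in \<open>auto simp: determined_by_def\<close>)
  also have "\<dots> = (1 - p\<^sup>2)\<^sup>2"
    unfolding power2_eq_square[of "1 - p\<^sup>2"]
    by (intro arg_cong2[of _ _ _ _ "(*)"] pr_nand) (use assms in auto)
  finally show ?thesis .
qed

text \<open>The exclusions form a 4-cycle. If \<open>e\<close> is present, its neighbours
  \<open>f\<close> and \<open>h\<close> are absent and \<open>g\<close> is free; if \<open>e\<close>
  is absent, a path with \<open>g\<close> in the middle remains.\<close>

lemma pr_nand_cycle:
  assumes "e \<in> A" "f \<in> A" "g \<in> A" "h \<in> A" "distinct [e, f, g, h]"
  shows "pr (\<lambda>x. \<not> (x e \<and> x f) \<and> \<not> (x f \<and> x g) \<and> \<not> (x g \<and> x h) \<and> \<not> (x h \<and> x e))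
    = (1 - p)\<^sup>2 * (1 + 2 * p - p\<^sup>2)"
proof -
  have 1: "pr (\<lambda>x. \<not> x f \<and> \<not> (x f \<and> x g) \<and> \<not> (x g \<and> x h) \<and> \<not> x h) = (1 - p)\<^sup>2"
  proof -
    have "(\<lambda>x. \<not> x f \<and> \<not> (x f \<and> x g) \<and> \<not> (x g \<and> x h) \<and> \<not> x h) = (\<lambda>x. \<not> x f \<and> \<not> x h)"
      by auto
    then show ?thesis
      using assms by (simp add: pr_not_not)
  qed
  have 2: "pr (\<lambda>x. \<not> (x f \<and> x g) \<and> \<not> (x g \<and> x h)) = 1 - 2 * p\<^sup>2 + p ^ 3"
  proof -
    have "pr (\<lambda>x. \<not> (x f \<and> x g) \<and> \<not> (x g \<and> x h)) = pr (\<lambda>x. \<not> (x g \<and> x f) \<and> \<not> (x g \<and> x h))"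
      by (rule arg_cong[of _ _ pr]) auto
    also have "\<dots> = 1 - 2 * p\<^sup>2 + p ^ 3"
      by (rule pr_nand_path) (use assms in auto)
    finally show ?thesis .
  qed
  have "f \<noteq> e" "g \<noteq> e" "h \<noteq> e"
    using assms by auto
  note ne = this
  \<comment> \<open>The same two values, in the implication form that simplification produces after
    conditioning on \<open>e\<close>.\<close>
  have 1: "pr (\<lambda>x. \<not> x f \<and> (x f \<longrightarrow> \<not> x g) \<and> (x g \<longrightarrow> \<not> x h) \<and> \<not> x h) = (1 - p)\<^sup>2"
    using 1 by simp
  have 2: "pr (\<lambda>x. (x f \<longrightarrow> \<not> x g) \<and> (x g \<longrightarrow> \<not> x h)) = 1 - 2 * p\<^sup>2 + p ^ 3"
    using 2 by simp
  show ?thesis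
    by (subst pr_split[OF assms(1)])
      (simp add: ne 1 2 power2_eq_square power3_eq_cube algebra_simps)
qed

end

section \<open>Bad pairs\<close>

text \<open>Works on the edge indicator, where independence lives. Excluding \<open>u\<close> and
  \<open>v\<close> from the range of \<open>w\<close> makes all edges mentioned distinct whenever
  \<open>u \<noteq> v\<close>.\<close>

definition bad :: "nat \<Rightarrow> (nat set \<Rightarrow> bool) \<Rightarrow> nat \<Rightarrow> nat \<Rightarrow> bool" where
  "bad n x u v \<longleftrightarrow> \<not> x {u, v} \<and> (\<forall>w\<in>{..<n} - {u, v}. \<not> (x {u, w} \<and> x {v, w}))"

lemma bad_sym: "bad n x u v \<longleftrightarrow> bad n x v u"
  by (auto simp: bad_def insert_commute)

text \<open>The distance is an infimum, but the costs are natural numbers: an infimum of at most 2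
  lies below 3, so some walk costs less than 3 and has at most two arcs.\<close>

lemma (in wf_digraph) unit_mu_le_2_iff:
  "\<mu> (\<lambda>_. 1) u v \<le> 2 \<longleftrightarrow> (\<exists>q. awalk u q v \<and> length q \<le> 2)"
proof
  have cost: "awalk_cost (\<lambda>_. 1) q = real (length q)" for q
    by (induction q) auto
  show "\<exists>q. awalk u q v \<and> length q \<le> 2" if "\<mu> (\<lambda>_. 1) u v \<le> 2"
  proof -
    have "\<mu> (\<lambda>_. 1) u v < 3"
      using that by (rule le_less_trans) simp
    then obtain q where "awalk u q v" "ereal (real (length q)) < 3"
      by (auto simp: \<mu>_def INF_less_iff cost)
    moreover have "length q \<le> 2"
      using \<open>ereal (real (length q)) < 3\<close> by simp
    ultimately show ?thesis by blast
  qed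
  show "\<mu> (\<lambda>_. 1) u v \<le> 2" if "\<exists>q. awalk u q v \<and> length q \<le> 2"
  proof -
    obtain q where q: "awalk u q v" "length q \<le> 2"
      using \<open>\<exists>q. awalk u q v \<and> length q \<le> 2\<close> by blast
    have "\<mu> (\<lambda>_. 1) u v \<le> ereal (real (length q))"
      using min_cost_le_walk_cost[OF q(1), of "\<lambda>_. 1"] by (simp add: cost)
    also have "\<dots> \<le> 2"
      using q(2) by simp
    finally show ?thesis .
  qed
qed

text \<open>Turns distances into the combinatorial condition. The index set holds the pairs with the
  larger vertex first, so each unordered pair is counted once in the later sums;
  \<open>bad_sym\<close> covers the other order.\<close>

lemma diameter_le_2_iff:
  assumes "\<And>e. x e \<Longrightarrow> e \<in> vertex_pairs n"
  shows "graph_diameter (with_proj (graph_of_edges n {e. x e})) \<le> 2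
    \<longleftrightarrow> (\<forall>(v, u)\<in>Sigma {..<n} lessThan. \<not> bad n x u v)"
proof -
  define G where "G = with_proj (graph_of_edges n {e. x e})"
  have [simp]: "verts G = {..<n}" "arcs G = {(u, v). x {u, v}}" "tail G = fst" "head G = snd"
    by (simp_all add: G_def graph_of_edges_def)
  have arc: "u < n \<and> v < n \<and> u \<noteq> v" if "x {u, v}" for u v
    using assms[OF that] by (cases "u = v") (auto simp: vertex_pairs_def)
  interpret wf_digraph G
    by unfold_locales (auto dest: arc)
  have dist: "\<mu> (\<lambda>_. 1) u v \<le> 2 \<longleftrightarrow> u = v \<or> \<not> bad n x u v" if "u < n" "v < n" for u v
  proof -
    have "(\<exists>q. awalk u q v \<and> length q \<le> 2) \<longleftrightarrow> u = v \<or> x {u, v} \<or> (\<exists>w. x {u, w} \<and> x {w, v})"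
    proof
      show "u = v \<or> x {u, v} \<or> (\<exists>w. x {u, w} \<and> x {w, v})" if "\<exists>q. awalk u q v \<and> length q \<le> 2"
      proof -
        obtain q where "awalk u q v" "length q \<le> 2"
          using \<open>\<exists>q. awalk u q v \<and> length q \<le> 2\<close> by blast
        then show ?thesis
          \<comment> \<open>The rule \<open>remdups_adj.cases\<close> is used only for its split
            into lists with no, one, or at least two elements.\<close>
          by (cases q rule: remdups_adj.cases) (auto simp: awalk_Nil_iff awalk_Cons_iff)
      qed
      assume "u = v \<or> x {u, v} \<or> (\<exists>w. x {u, w} \<and> x {w, v})"
      then consider "u = v" | "x {u, v}" | w where "x {u, w}" "x {w, v}"
        by blast
      then show "\<exists>q. awalk u q v \<and> length q \<le> 2"
      proof cases
        case 1
        with that show ?thesis by (intro exI[of _ "[]"]) (simp add: awalk_Nil_iff)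
      next
        case 2
        with that show ?thesis
          by (intro exI[of _ "[(u, v)]"]) (simp add: awalk_Nil_iff awalk_Cons_iff)
      next
        case (3 w)
        with that show ?thesis
          by (intro exI[of _ "[(u, w), (w, v)]"]) (simp add: awalk_Nil_iff awalk_Cons_iff)
      qed
    qed
    \<comment> \<open>Edges join distinct vertices below \<open>n\<close>, so a midpoint
      \<open>w\<close> automatically lies in the range used by \<open>bad\<close>.\<close>
    also have "\<dots> \<longleftrightarrow> u = v \<or> \<not> bad n x u v"
      by (auto simp: bad_def insert_commute dest: arc)
    finally show ?thesis
      by (simp only: unit_mu_le_2_iff)
  qed
  have "graph_diameter G \<le> 2 \<longleftrightarrow> (\<forall>u<n. \<forall>v<n. u = v \<or> \<not> bad n x u v)"
  proof -
    have "graph_diameter G \<le> 2 \<longleftrightarrow> (\<forall>u\<in>{..<n}. \<forall>v\<in>{..<n}. \<mu> (\<lambda>_. 1) u v \<le> 2)"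
      by (simp only: graph_diameter_def SUP_le_iff \<open>verts G = {..<n}\<close>)
    also have "\<dots> \<longleftrightarrow> (\<forall>u\<in>{..<n}. \<forall>v\<in>{..<n}. u = v \<or> \<not> bad n x u v)"
      by (intro ball_cong refl dist) simp_all
    finally show ?thesis
      by (simp only: Ball_def lessThan_iff)
  qed
  also have "\<dots> \<longleftrightarrow> (\<forall>(v, u)\<in>Sigma {..<n} lessThan. \<not> bad n x u v)"
  proof
    assume none: "\<forall>(v, u)\<in>Sigma {..<n} lessThan. \<not> bad n x u v"
    show "\<forall>u<n. \<forall>v<n. u = v \<or> \<not> bad n x u v"
    proof (intro allI impI)
      fix u v assume "u < n" "v < n"
      then show "u = v \<or> \<not> bad n x u v"
        using none bad_sym[of n x u v] by (cases u v rule: linorder_cases) auto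
    qed
  next
    assume all: "\<forall>u<n. \<forall>v<n. u = v \<or> \<not> bad n x u v"
    have "\<not> bad n x u v" if "v < n" "u < v" for u v
    proof -
      have "u < n" "u \<noteq> v"
        using that by simp_all
      then show ?thesis
        using all that by blast
    qed
    then show "\<forall>(v, u)\<in>Sigma {..<n} lessThan. \<not> bad n x u v"
      by simp
  qed
  finally show ?thesis
    by (simp add: G_def)
qed

section \<open>Probabilities of bad pairs\<close>

lemma finite_vertex_pairs: "finite (vertex_pairs n)"
  by (rule finite_subset[of _ "Pow {..<n}"]) (auto simp: vertex_pairs_def)

lemma vertex_pair_in [simp]: "{u, v} \<in> vertex_pairs n \<longleftrightarrow> u < n \<and> v < n \<and> u \<noteq> v"
  by (cases "u = v") (auto simp: vertex_pairs_def)

lemma card_diff_lessThan: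
  assumes "S \<subseteq> {..<n}"
  shows "card ({..<n} - S) = n - card S"
  using assms by (simp add: card_Diff_subset finite_subset)

locale edge_probability =
  fixes n :: nat and p :: real
  assumes p_nonneg: "0 \<le> p" and p_le_1: "p \<le> 1"

sublocale edge_probability \<subseteq> bernoulli_product "vertex_pairs n" p
  by unfold_locales (simp_all add: finite_vertex_pairs p_nonneg p_le_1)

context edge_probability
begin

text \<open>The edge \<open>{u, v}\<close> and the edge pairs \<open>{u, w}\<close>,
  \<open>{v, w}\<close> for the \<open>n - 2\<close> other vertices \<open>w\<close> are disjoint
  sets of coordinates, so the probabilities multiply.\<close>

lemma pr_bad:
  assumes "u < n" "v < n" "u \<noteq> v"
  shows "pr (\<lambda>x. bad n x u v) = (1 - p) * (1 - p\<^sup>2) ^ (n - 2)"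
proof -
  define W where "W = {..<n} - {u, v}"
  have W: "w < n" "w \<noteq> u" "w \<noteq> v" "u \<noteq> w" "v \<noteq> w" if "w \<in> W" for w
    using that by (auto simp: W_def)
  have "pr (\<lambda>x. bad n x u v) = pr (\<lambda>x. \<not> x {u, v}) * pr (\<lambda>x. \<forall>w\<in>W. \<not> (x {u, w} \<and> x {v, w}))"
    unfolding bad_def W_def[symmetric]
  proof (rule pr_conj_indep[where S = "{{u, v}}"])
    show "determined_by (\<Union>w\<in>W. {{u, w}, {v, w}}) (\<lambda>x. \<forall>w\<in>W. \<not> (x {u, w} \<and> x {v, w}))"
      by (rule determined_by_Ball) (auto simp: determined_by_def)
  qed (use assms in \<open>auto simp: determined_by_def doubleton_eq_iff W_def\<close>)
  also have "pr (\<lambda>x. \<not> x {u, v}) = 1 - p"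
    using assms by (simp add: pr_not)
  also have "pr (\<lambda>x. \<forall>w\<in>W. \<not> (x {u, w} \<and> x {v, w})) = (1 - p\<^sup>2) ^ card W"
  proof (rule pr_Ball_indep[where S = "\<lambda>w. {{u, w}, {v, w}}"])
    fix w assume w: "w \<in> W"
    show "pr (\<lambda>x. \<not> (x {u, w} \<and> x {v, w})) = 1 - p\<^sup>2"
      using assms W[OF w]
      by (intro pr_nand) (auto simp: doubleton_eq_iff)
  qed (use assms in \<open>auto simp: W_def determined_by_def doubleton_eq_iff\<close>)
  also have "card W = n - 2"
    using assms by (simp add: W_def card_diff_lessThan)
  finally show ?thesis .
qed

text \<open>Each of the \<open>n - 3\<close> vertices outside contributes a path of exclusions with
  the edge to the common vertex \<open>a\<close> in the middle.\<close>

lemma pr_bad_bad_adjacent: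
  assumes "a < n" "b < n" "c < n" "a \<noteq> b" "a \<noteq> c" "b \<noteq> c"
  shows "pr (\<lambda>x. bad n x a b \<and> bad n x a c) = (1 - p)\<^sup>2 * (1 - 2 * p\<^sup>2 + p ^ 3) ^ (n - 3)"
proof -
  define W where "W = {..<n} - {a, b, c}"
  have W: "w < n" "w \<noteq> a" "w \<noteq> b" "w \<noteq> c" "a \<noteq> w" "b \<noteq> w" "c \<noteq> w" if "w \<in> W" for w
    using that by (auto simp: W_def)
  have split: "{..<n} - {a, b} = insert c W" "{..<n} - {a, c} = insert b W"
    using assms by (auto simp: W_def)
  define Q where "Q w x \<longleftrightarrow> \<not> (x {a, w} \<and> x {b, w}) \<and> \<not> (x {a, w} \<and> x {c, w})"
    for w and x :: "nat set \<Rightarrow> bool"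
  \<comment> \<open>The conditions with \<open>w = c\<close> for the first pair and
    \<open>w = b\<close> for the second hold automatically, since each involves an edge already
    required to be absent.\<close>
  have "(\<lambda>x. bad n x a b \<and> bad n x a c) = (\<lambda>x. (\<not> x {a, b} \<and> \<not> x {a, c}) \<and> (\<forall>w\<in>W. Q w x))"
    by (rule ext) (auto simp: bad_def split Q_def)
  moreover have "pr (\<lambda>x. (\<not> x {a, b} \<and> \<not> x {a, c}) \<and> (\<forall>w\<in>W. Q w x)) =
      pr (\<lambda>x. \<not> x {a, b} \<and> \<not> x {a, c}) * pr (\<lambda>x. \<forall>w\<in>W. Q w x)"
  proof (rule pr_conj_indep)
    show "determined_by (\<Union>w\<in>W. {{a, w}, {b, w}, {c, w}}) (\<lambda>x. \<forall>w\<in>W. Q w x)"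
      by (rule determined_by_Ball) (auto simp: determined_by_def Q_def)
    show "determined_by {{a, b}, {a, c}} (\<lambda>x. \<not> x {a, b} \<and> \<not> x {a, c})"
      by (auto simp: determined_by_def)
  qed (use assms in \<open>auto simp: doubleton_eq_iff W_def\<close>)
  moreover have "pr (\<lambda>x. \<not> x {a, b} \<and> \<not> x {a, c}) = (1 - p)\<^sup>2"
    using assms
    by (intro pr_not_not) (auto simp: doubleton_eq_iff)
  moreover have "pr (\<lambda>x. \<forall>w\<in>W. Q w x) = (1 - 2 * p\<^sup>2 + p ^ 3) ^ card W"
  proof (rule pr_Ball_indep[where S = "\<lambda>w. {{a, w}, {b, w}, {c, w}}"])
    fix w assume w: "w \<in> W"
    show "pr (Q w) = 1 - 2 * p\<^sup>2 + p ^ 3"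
      unfolding Q_def[abs_def]
      using assms W[OF w]
      by (intro pr_nand_path) (auto simp: doubleton_eq_iff)
  qed (use assms in \<open>auto simp: W_def determined_by_def doubleton_eq_iff Q_def\<close>)
  moreover have "card W = n - 3"
    using assms by (simp add: W_def card_diff_lessThan)
  ultimately show ?thesis by simp
qed

text \<open>The edges \<open>{a, b}\<close> and \<open>{c, d}\<close> are absent, the four cross
  edges carry a 4-cycle of exclusions, and each of the \<open>n - 4\<close> other vertices
  contributes two independent exclusions.\<close>

lemma pr_bad_bad_disjoint:
  assumes "a < n" "b < n" "c < n" "d < n" "distinct [a, b, c, d]"
  shows "pr (\<lambda>x. bad n x a b \<and> bad n x c d)
    = (1 - p) ^ 4 * (1 + 2 * p - p\<^sup>2) * (1 - p\<^sup>2) ^ (2 * (n - 4))"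
proof -
  define W where "W = {..<n} - {a, b, c, d}"
  have W: "w < n" "w \<noteq> a" "w \<noteq> b" "w \<noteq> c" "w \<noteq> d" "a \<noteq> w" "b \<noteq> w" "c \<noteq> w" "d \<noteq> w"
    if "w \<in> W" for w
    using that by (auto simp: W_def)
  have split: "{..<n} - {a, b} = insert c (insert d W)" "{..<n} - {c, d} = insert a (insert b W)"
    using assms by (auto simp: W_def)
  have comm: "{c, a} = {a, c}" "{d, a} = {a, d}" "{c, b} = {b, c}" "{d, b} = {b, d}"
    by auto
  define P where "P x \<longleftrightarrow> \<not> x {a, b} \<and> \<not> x {c, d} \<and> \<not> (x {a, c} \<and> x {b, c}) \<and>
    \<not> (x {a, d} \<and> x {b, d}) \<and> \<not> (x {a, c} \<and> x {a, d}) \<and> \<not> (x {b, c} \<and> x {b, d})"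
    for x :: "nat set \<Rightarrow> bool"
  define Q where "Q w x \<longleftrightarrow> \<not> (x {a, w} \<and> x {b, w}) \<and> \<not> (x {c, w} \<and> x {d, w})"
    for w and x :: "nat set \<Rightarrow> bool"
  have "(\<lambda>x. bad n x a b \<and> bad n x c d) = (\<lambda>x. P x \<and> (\<forall>w\<in>W. Q w x))"
    by (rule ext) (auto simp: bad_def split P_def Q_def comm)
  moreover have "pr (\<lambda>x. P x \<and> (\<forall>w\<in>W. Q w x)) = pr P * pr (\<lambda>x. \<forall>w\<in>W. Q w x)"
  proof (rule pr_conj_indep)
    show "determined_by (\<Union>w\<in>W. {{a, w}, {b, w}, {c, w}, {d, w}}) (\<lambda>x. \<forall>w\<in>W. Q w x)"
      by (rule determined_by_Ball) (auto simp: determined_by_def Q_def)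
    show "determined_by {{a, b}, {c, d}, {a, c}, {b, c}, {a, d}, {b, d}} P"
      by (auto simp: determined_by_def P_def)
    have "e \<noteq> f" if "w \<in> W" "e \<in> {{a, b}, {c, d}, {a, c}, {b, c}, {a, d}, {b, d}}"
      "f \<in> {{a, w}, {b, w}, {c, w}, {d, w}}" for e f w
    proof -
      have "w \<notin> e" "w \<in> f"
        using that W[OF that(1)] by auto
      then show ?thesis by blast
    qed
    then show "{{a, b}, {c, d}, {a, c}, {b, c}, {a, d}, {b, d}} \<inter>
        (\<Union>w\<in>W. {{a, w}, {b, w}, {c, w}, {d, w}}) = {}"
      by blast
  qed (use assms in auto)
  moreover have "pr P = (1 - p)\<^sup>2 * ((1 - p)\<^sup>2 * (1 + 2 * p - p\<^sup>2))"
  proof -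
    \<comment> \<open>The exclusions among the cross edges, listed in cyclic order to match
      \<open>pr_nand_cycle\<close>.\<close>
    define C where "C x \<longleftrightarrow> \<not> (x {a, c} \<and> x {b, c}) \<and> \<not> (x {b, c} \<and> x {b, d}) \<and>
      \<not> (x {b, d} \<and> x {a, d}) \<and> \<not> (x {a, d} \<and> x {a, c})"
      for x :: "nat set \<Rightarrow> bool"
    have "P = (\<lambda>x. (\<not> x {a, b} \<and> \<not> x {c, d}) \<and> C x)"
      by (rule ext) (auto simp: P_def C_def)
    moreover have "pr (\<lambda>x. (\<not> x {a, b} \<and> \<not> x {c, d}) \<and> C x) =
        pr (\<lambda>x. \<not> x {a, b} \<and> \<not> x {c, d}) * pr C"
      by (rule pr_conj_indep[where S = "{{a, b}, {c, d}}" and T = "{{a, c}, {b, c}, {b, d}, {a, d}}"])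
        (use assms in \<open>auto simp: determined_by_def C_def doubleton_eq_iff\<close>)
    moreover have "pr C = (1 - p)\<^sup>2 * (1 + 2 * p - p\<^sup>2)"
      unfolding C_def[abs_def]
      by (rule pr_nand_cycle) (use assms in \<open>auto simp: doubleton_eq_iff\<close>)
    moreover have "pr (\<lambda>x. \<not> x {a, b} \<and> \<not> x {c, d}) = (1 - p)\<^sup>2"
      by (rule pr_not_not) (use assms in \<open>auto simp: doubleton_eq_iff\<close>)
    ultimately show ?thesis
      by simp
  qed
  moreover have "pr (\<lambda>x. \<forall>w\<in>W. Q w x) = ((1 - p\<^sup>2)\<^sup>2) ^ card W"
  proof (rule pr_Ball_indep[where S = "\<lambda>w. {{a, w}, {b, w}, {c, w}, {d, w}}"])
    fix w assume w: "w \<in> W"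
    show "pr (Q w) = (1 - p\<^sup>2)\<^sup>2"
      unfolding Q_def[abs_def]
      using assms W[OF w]
      by (intro pr_nand_nand) (auto simp: doubleton_eq_iff)
  qed (use assms in \<open>auto simp: W_def determined_by_def doubleton_eq_iff Q_def\<close>)
  moreover have "card W = n - 4"
    using assms by (simp add: W_def card_diff_lessThan)
  ultimately show ?thesis by (simp add: power_mult power2_eq_square power4_eq_xxxx)
qed

text \<open>\<open>q\<close> is the probability that a given pair is bad; \<open>s\<close> and
  \<open>d\<close> below are the probabilities that two pairs are both bad when they share exactly
  one vertex, or none.\<close>

definition q :: real where
  "q = (1 - p) * (1 - p\<^sup>2) ^ (n - 2)"

definition s :: real where
  "s = (1 - p)\<^sup>2 * (1 - 2 * p\<^sup>2 + p ^ 3) ^ (n - 3)"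

definition d :: real where
  "d = (1 - p) ^ 4 * (1 + 2 * p - p\<^sup>2) * (1 - p\<^sup>2) ^ (2 * (n - 4))"

lemma q_s_d_nonneg: "0 \<le> q" "0 \<le> s" "0 \<le> d"
proof -
  have "0 \<le> 1 - p" "0 \<le> 1 - p\<^sup>2"
    using p_nonneg p_le_1 by (auto simp: power_le_one)
  have "1 - 2 * p\<^sup>2 + p ^ 3 = (1 - p) * (1 + p * (1 - p))"
    by (simp add: power2_eq_square power3_eq_cube algebra_simps)
  moreover have "1 + 2 * p - p\<^sup>2 = 1 + p + p * (1 - p)"
    by (simp add: power2_eq_square algebra_simps)
  moreover have "0 \<le> (1 - p) * (1 + p * (1 - p))" "0 \<le> 1 + p + p * (1 - p)"
    using p_nonneg \<open>0 \<le> 1 - p\<close> by simp_all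
  ultimately have "0 \<le> 1 - 2 * p\<^sup>2 + p ^ 3" "0 \<le> 1 + 2 * p - p\<^sup>2"
    by simp_all
  then show "0 \<le> q" "0 \<le> s" "0 \<le> d"
    using \<open>0 \<le> 1 - p\<close> \<open>0 \<le> 1 - p\<^sup>2\<close> by (simp_all add: q_def s_def d_def)
qed

section \<open>Counting pairs and summing joint probabilities\<close>

abbreviation pairs :: "(nat \<times> nat) set" where
  "pairs \<equiv> Sigma {..<n} lessThan"

lemma card_pairs: "real (card pairs) = real n * (real n - 1) / 2"
proof -
  have "real (card pairs) = (\<Sum>v<n. real v)"
    by (simp add: card_SigmaI)
  also have "\<dots> = real n * (real n - 1) / 2"
    by (induction n) (auto simp: field_simps)
  finally show ?thesis .
qed

text \<open>A pair containing \<open>a\<close> is determined by its other endpoint \<open>w\<close>,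
  for which \<open>n - 1\<close> values remain; \<open>max\<close> and \<open>min\<close> restore
  the order within the pair.\<close>

lemma card_pairs_containing:
  assumes "a < n"
  shows "(\<Sum>(y, x)\<in>pairs. of_bool (y = a \<or> x = a)) \<le> real n - 1"
proof -
  have "{e \<in> pairs. fst e = a \<or> snd e = a} \<subseteq> (\<lambda>w. (max w a, min w a)) ` ({..<n} - {a})"
  proof
    fix e assume "e \<in> {e \<in> pairs. fst e = a \<or> snd e = a}"
    then obtain y x where e: "e = (y, x)" "x < y" "y < n" "y = a \<or> x = a"
      by auto
    show "e \<in> (\<lambda>w. (max w a, min w a)) ` ({..<n} - {a})"
    proof (rule image_eqI)
      show "e = (max (if y = a then x else y) a, min (if y = a then x else y) a)"
        using e by auto
      show "(if y = a then x else y) \<in> {..<n} - {a}"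
        using e by auto
    qed
  qed
  then have "card {e \<in> pairs. fst e = a \<or> snd e = a} \<le> card ({..<n} - {a})"
    by (rule surj_card_le[rotated]) simp
  also have "\<dots> = n - 1"
    using assms by simp
  finally have "real (card {e \<in> pairs. fst e = a \<or> snd e = a}) \<le> real n - 1"
    using assms by linarith
  moreover have "(\<Sum>(y, x)\<in>pairs. of_bool (y = a \<or> x = a)) =
      real (card {e \<in> pairs. fst e = a \<or> snd e = a})"
    by (simp add: case_prod_beta' of_bool_def sum.If_cases Int_def)
  ultimately show ?thesis by simp
qed

text \<open>Merges equal, adjacent and disjoint pairs into one sum of nonnegative terms that
  dominates each case and can be summed separately. Two distinct pairs can share a vertex in four
  ways, and \<open>bad_sym\<close> brings the shared vertex to the front.\<close>

lemma pr_bad_bad_le: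
  assumes "u < v" "v < n" "x < y" "y < n"
  shows "pr (\<lambda>z. bad n z u v \<and> bad n z x y) \<le>
    q * of_bool ((y, x) = (v, u))
    + s * (of_bool (y = u \<or> x = u) + of_bool (y = v \<or> x = v))
    + d" (is "?f \<le> _")
proof -
  consider "(y, x) = (v, u)" | "x = u" "y \<noteq> v" | "y = v" "x \<noteq> u" | "x = v" | "y = u"
    | "distinct [u, v, x, y]"
    using assms by (auto simp: distinct_length_2_or_more)
  then show ?thesis
  proof cases
    case 1
    then have "?f = q"
      using assms pr_bad[of u v] by (simp add: q_def)
    then show ?thesis
      using 1 q_s_d_nonneg by simp
  next
    case 2
    then have "?f = s"
      using assms pr_bad_bad_adjacent[of u v y] by (simp add: s_def)
    then show ?thesis
      using 2 q_s_d_nonneg by simp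
  next
    case 3
    then have "?f = s"
      using assms pr_bad_bad_adjacent[of v u x] by (simp add: s_def bad_sym[of n _ v])
    then show ?thesis
      using 3 q_s_d_nonneg by simp
  next
    case 4
    then have "?f = s"
      using assms pr_bad_bad_adjacent[of v u y] by (simp add: s_def bad_sym[of n _ v u])
    then show ?thesis
      using 4 assms q_s_d_nonneg by simp
  next
    case 5
    then have "?f = s"
      using assms pr_bad_bad_adjacent[of u v x] by (simp add: s_def bad_sym[of n _ u x])
    then show ?thesis
      using 5 assms q_s_d_nonneg by simp
  next
    case 6
    then have "?f = d"
      using assms unfolding d_def by (intro pr_bad_bad_disjoint) auto
    then show ?thesis
      using q_s_d_nonneg by simp
  qed
qed

lemma sum_pr_bad_bad_le:
  assumes "(v, u) \<in> pairs"
  shows "(\<Sum>(y, x)\<in>pairs. pr (\<lambda>z. bad n z u v \<and> bad n z x y)) \<le>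
    q + 2 * (real n - 1) * s
    + real (card pairs) * d"
proof -
  have uv: "u < v" "v < n"
    using assms by auto
  have "(\<Sum>(y, x)\<in>pairs. pr (\<lambda>z. bad n z u v \<and> bad n z x y)) \<le>
      (\<Sum>(y, x)\<in>pairs. q * of_bool ((y, x) = (v, u))
        + s * (of_bool (y = u \<or> x = u) + of_bool (y = v \<or> x = v)) + d)"
  proof (rule sum_mono)
    fix e assume "e \<in> pairs"
    then obtain y x where e: "e = (y, x)" "x < y" "y < n"
      by auto
    show "(case e of (y, x) \<Rightarrow> pr (\<lambda>z. bad n z u v \<and> bad n z x y)) \<le>
        (case e of (y, x) \<Rightarrow> q * of_bool ((y, x) = (v, u))
          + s * (of_bool (y = u \<or> x = u) + of_bool (y = v \<or> x = v)) + d)"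
      unfolding e(1) prod.case by (rule pr_bad_bad_le[OF uv e(2,3)])
  qed
  also have "\<dots> = q * (\<Sum>e\<in>pairs. of_bool (e = (v, u)))
      + s * ((\<Sum>(y, x)\<in>pairs. of_bool (y = u \<or> x = u)) + (\<Sum>(y, x)\<in>pairs. of_bool (y = v \<or> x = v)))
      + real (card pairs) * d"
    by (simp only: case_prod_beta' sum.distrib sum_distrib_left distrib_left prod.collapse sum_constant)
  also have "(\<Sum>e\<in>pairs. of_bool (e = (v, u))) = (1 :: real)"
    using assms by (simp add: of_bool_def sum.delta)
  also have "q * 1 + s * ((\<Sum>(y, x)\<in>pairs. of_bool (y = u \<or> x = u)) + (\<Sum>(y, x)\<in>pairs. of_bool (y = v \<or> x = v)))
      + real (card pairs) * d \<le> q * 1 + s * ((real n - 1) + (real n - 1)) + real (card pairs) * d"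
    using uv q_s_d_nonneg
    by (intro add_mono mult_left_mono card_pairs_containing) (auto simp: sum_nonneg)
  finally show ?thesis
    by (simp add: algebra_simps)
qed

section \<open>The lower bound and the second moment estimate\<close>

lemma prob_diameter_at_most_two_eq:
  "prob_diameter_at_most_two n p = pr (\<lambda>x. \<forall>e\<in>pairs. \<not> bad n x (snd e) (fst e))"
  unfolding prob_diameter_at_most_two_def random_graph_def pr_def measure_map_pmf
proof (rule measure_pmf.finite_measure_eq_AE)
  show "AE x in measure_pmf (Pi_pmf (vertex_pairs n) False (\<lambda>_. bernoulli_pmf p)).
      x \<in> (\<lambda>x. graph_of_edges n {e. x e}) -` {G. graph_diameter (with_proj G) \<le> 2} \<longleftrightarrow>
      x \<in> {x. \<forall>e\<in>pairs. \<not> bad n x (snd e) (fst e)}"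
  \<comment> \<open>The two events need to agree only on the support, where every present edge is a
    genuine vertex pair; \<open>diameter_le_2_iff\<close> assumes this.\<close>
  proof (rule AE_pmfI)
    fix x assume "x \<in> set_pmf (Pi_pmf (vertex_pairs n) False (\<lambda>_. bernoulli_pmf p))"
    then have "e \<in> vertex_pairs n" if "x e" for e
      using that set_Pi_pmf_subset[OF finite_vertex_pairs, of n False "\<lambda>_. bernoulli_pmf p"] by auto
    from diameter_le_2_iff[OF this]
    show "x \<in> (\<lambda>x. graph_of_edges n {e. x e}) -` {G. graph_diameter (with_proj G) \<le> 2} \<longleftrightarrow>
        x \<in> {x. \<forall>e\<in>pairs. \<not> bad n x (snd e) (fst e)}"
      by (simp only: vimage_eq mem_Collect_eq case_prod_beta')
  qed
qed simp_all

lemma prob_diameter_at_most_two_ge: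
  "1 - real n ^ 2 * (1 - p\<^sup>2) ^ (n - 2) * (1 - p) / 2 \<le> prob_diameter_at_most_two n p"
proof -
  define M where "M = measure_pmf (Pi_pmf (vertex_pairs n) False (\<lambda>_. bernoulli_pmf p))"
  have "1 - prob_diameter_at_most_two n p =
      measure M (\<Union>e\<in>pairs. {x. bad n x (snd e) (fst e)})"
  proof -
    have "(\<Union>e\<in>pairs. {x. bad n x (snd e) (fst e)}) =
        UNIV - {x. \<forall>e\<in>pairs. \<not> bad n x (snd e) (fst e)}"
      by blast
    then show ?thesis
      by (simp add: prob_diameter_at_most_two_eq pr_def M_def measure_pmf.prob_compl[simplified])
  qed
  also have "\<dots> \<le> (\<Sum>e\<in>pairs. measure M {x. bad n x (snd e) (fst e)})"
    unfolding M_def by (rule measure_pmf.finite_measure_subadditive_finite) auto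
  also have "\<dots> = (\<Sum>e\<in>pairs. q)"
    by (rule sum.cong) (auto simp: M_def pr_bad[unfolded pr_def] q_def)
  also have "\<dots> = real n * (real n - 1) / 2 * q"
    by (simp only: sum_constant card_pairs)
  also have "\<dots> \<le> real n ^ 2 / 2 * q"
    using q_s_d_nonneg(1) by (intro mult_right_mono) (auto simp: power2_eq_square algebra_simps)
  finally show ?thesis
    by (simp add: q_def mult_ac)
qed

text \<open>\<open>K\<close> is the number of pairs, so \<open>K * q\<close> is the mean number of
  bad pairs, and the first term on the right bounds its second moment.\<close>

lemma second_moment_estimate:
  defines "K \<equiv> real n * (real n - 1) / 2"
  shows "prob_diameter_at_most_two n p * (K * q)\<^sup>2 \<le>
    K * (q + 2 * (real n - 1) * s
      + K * d) - (K * q)\<^sup>2"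
proof -
  have "(\<Sum>e\<in>pairs. pr (\<lambda>x. bad n x (snd e) (fst e))) = (\<Sum>e\<in>pairs. q)"
    by (rule sum.cong) (auto simp: pr_bad q_def)
  then have m: "(\<Sum>e\<in>pairs. pr (\<lambda>x. bad n x (snd e) (fst e))) = K * q"
    by (simp only: sum_constant card_pairs K_def)
  have "(\<Sum>e\<in>pairs. \<Sum>f\<in>pairs. pr (\<lambda>x. bad n x (snd e) (fst e) \<and> bad n x (snd f) (fst f))) \<le>
    (\<Sum>e\<in>pairs. q + 2 * (real n - 1) * s
      + K * d)"
    unfolding K_def card_pairs[symmetric]
  proof (rule sum_mono)
    fix e assume "e \<in> pairs"
    \<comment> \<open>Once the projections are reduced, this is
      \<open>(fst e, snd e) \<in> pairs\<close>, the premise of the instance used next.\<close>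
    then have "(snd (snd e, fst e), fst (snd e, fst e)) \<in> pairs"
      by simp
    then show "(\<Sum>f\<in>pairs. pr (\<lambda>x. bad n x (snd e) (fst e) \<and> bad n x (snd f) (fst f)))
        \<le> q + 2 * (real n - 1) * s + real (card pairs) * d"
      using sum_pr_bad_bad_le[of "fst e" "snd e"] by (simp only: case_prod_beta' fst_conv snd_conv)
  qed
  also have "\<dots> = K * (q + 2 * (real n - 1) * s
      + K * d)"
    by (simp only: sum_constant card_pairs K_def)
  finally show ?thesis
    using second_moment_bound[of pairs "\<lambda>e x. bad n x (snd e) (fst e)"]
    by (simp add: m prob_diameter_at_most_two_eq)
qed

end

section \<open>Numerical estimates\<close>

text \<open>Compares one outside vertex at a time: multiplying
  \<open>p ^ 3 / (1 - p)\<^sup>2\<close> by \<open>(1 - p\<^sup>2)\<^sup>2\<close> gives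
  \<open>p ^ 3 * (1 + p)\<^sup>2\<close>, and the surplus has nonnegative coefficients. Passing from
  exponent \<open>2 * (n - 3)\<close> to \<open>2 * (n - 2)\<close> costs the factor
  \<open>1 / (1 - p\<^sup>2)\<^sup>2\<close>.\<close>

lemma adjacent_ratio_bound:
  fixes p :: real
  assumes "0 \<le> p" "p < 1" "n \<ge> 3"
  shows "(1 - 2 * p\<^sup>2 + p ^ 3) ^ (n - 3) \<le>
    (1 - p\<^sup>2) ^ (2 * (n - 2)) * (1 / (1 - p\<^sup>2)\<^sup>2) * (1 + p ^ 3 / (1 - p)\<^sup>2) ^ n"
proof -
  define Y where "Y = 1 + p ^ 3 / (1 - p)\<^sup>2"
  have "1 \<le> Y"
    using assms by (simp add: Y_def)
  have p2: "1 - p\<^sup>2 > 0"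
    using assms by (simp add: power_less_one_iff)
  have "1 - 2 * p\<^sup>2 + p ^ 3 = (1 - p) * (1 + p * (1 - p))"
    by (simp add: power2_eq_square power3_eq_cube algebra_simps)
  then have nonneg: "0 \<le> 1 - 2 * p\<^sup>2 + p ^ 3"
    using assms by simp
  have "(1 - p\<^sup>2)\<^sup>2 = (1 - p)\<^sup>2 * (1 + p)\<^sup>2"
    by (simp add: power2_eq_square algebra_simps)
  then have "(1 - p\<^sup>2)\<^sup>2 * Y = (1 - p\<^sup>2)\<^sup>2 + p ^ 3 * (1 + p)\<^sup>2"
    using assms by (simp add: Y_def distrib_left)
  also have "\<dots> - (1 - 2 * p\<^sup>2 + p ^ 3) = p ^ 4 + p ^ 3 * (2 * p + p\<^sup>2)"
    by (simp add: power2_eq_square power3_eq_cube power4_eq_xxxx algebra_simps)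
  finally have "(1 - p\<^sup>2)\<^sup>2 * Y - (1 - 2 * p\<^sup>2 + p ^ 3) = p ^ 4 + p ^ 3 * (2 * p + p\<^sup>2)" .
  moreover have "\<dots> \<ge> 0"
    using assms by simp
  ultimately have "1 - 2 * p\<^sup>2 + p ^ 3 \<le> (1 - p\<^sup>2)\<^sup>2 * Y"
    by linarith
  then have "(1 - 2 * p\<^sup>2 + p ^ 3) ^ (n - 3) \<le> ((1 - p\<^sup>2)\<^sup>2 * Y) ^ (n - 3)"
    using nonneg by (rule power_mono)
  also have "\<dots> = (1 - p\<^sup>2) ^ (2 * (n - 3)) * Y ^ (n - 3)"
    by (simp add: power_mult_distrib power_mult)
  also have "\<dots> \<le> (1 - p\<^sup>2) ^ (2 * (n - 3)) * Y ^ n"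
    using \<open>1 \<le> Y\<close> p2 by (intro mult_left_mono power_increasing) auto
  also have "(1 - p\<^sup>2) ^ (2 * (n - 3)) = (1 - p\<^sup>2) ^ (2 * (n - 2)) * (1 / (1 - p\<^sup>2)\<^sup>2)"
  proof -
    have "2 * (n - 2) = 2 * (n - 3) + 2"
      using assms by simp
    then show ?thesis
      using p2 by (simp only: power_add) simp
  qed
  finally show ?thesis
    by (simp add: Y_def)
qed

text \<open>The \<open>n - 4\<close> outside vertices contribute equally to both sides, leaving an
  inequality free of \<open>n\<close>. The coefficient 4 arises because
  \<open>(1 - p)\<^sup>2 * (1 + p) ^ 4\<close> agrees with \<open>1 + 2 * p - p\<^sup>2\<close> up
  to a first deviation of \<open>- 4 * p ^ 3\<close>.\<close>

lemma disjoint_ratio_bound: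
  fixes p :: real
  assumes "0 \<le> p" "p < 1" "n \<ge> 4"
  shows "(1 - p)\<^sup>2 * (1 + 2 * p - p\<^sup>2) * (1 - p\<^sup>2) ^ (2 * (n - 4)) \<le>
    (1 - p\<^sup>2) ^ (2 * (n - 2)) * (1 + 4 * (p ^ 3 / (1 - p)\<^sup>2) * (1 / (1 + p) ^ 3))"
proof -
  define t where "t = p ^ 3 / (1 - p)\<^sup>2"
  define b where "b = 1 / (1 + p) ^ 3"
  have p2: "1 - p\<^sup>2 > 0"
    using assms by (simp add: power_less_one_iff)
  have "(1 - p\<^sup>2) ^ 4 * (t * b) =
      (1 - p)\<^sup>2 * (1 + p) * (t * (1 - p)\<^sup>2) * (b * (1 + p) ^ 3)"
    by algebra
  moreover have "t * (1 - p)\<^sup>2 = p ^ 3" "b * (1 + p) ^ 3 = 1"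
    using assms by (simp_all add: t_def b_def)
  ultimately have "(1 - p\<^sup>2) ^ 4 * (t * b) = (1 - p)\<^sup>2 * (1 + p) * p ^ 3"
    by simp
  moreover have "(1 - p\<^sup>2) ^ 4 + 4 * ((1 - p)\<^sup>2 * (1 + p) * p ^ 3) - (1 - p)\<^sup>2 * (1 + 2 * p - p\<^sup>2)
      = (1 - p)\<^sup>2 * (3 * p ^ 4 + 2 * p ^ 5 + p ^ 6)"
    by algebra
  moreover have "\<dots> \<ge> 0"
    using assms by simp
  ultimately have "(1 - p)\<^sup>2 * (1 + 2 * p - p\<^sup>2) \<le> (1 - p\<^sup>2) ^ 4 * (1 + 4 * t * b)"
    by (simp add: algebra_simps)
  then have "(1 - p)\<^sup>2 * (1 + 2 * p - p\<^sup>2) * (1 - p\<^sup>2) ^ (2 * (n - 4)) \<le>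
      (1 - p\<^sup>2) ^ 4 * (1 + 4 * t * b) * (1 - p\<^sup>2) ^ (2 * (n - 4))"
    using p2 by (intro mult_right_mono) auto
  also have "\<dots> = (1 - p\<^sup>2) ^ (2 * (n - 2)) * (1 + 4 * t * b)"
  proof -
    have "2 * (n - 2) = 2 * (n - 4) + 4"
      using assms by simp
    then show ?thesis
      by (simp only: power_add) simp
  qed
  finally show ?thesis
    by (simp add: t_def b_def)
qed

text \<open>Responsible for the constant 8 in the upper bound, which arises as 4 times this 2;
  equality holds at \<open>p = 0\<close>.\<close>

lemma coefficient_bound:
  fixes p :: real
  assumes "0 \<le> p" "p \<le> 2 / 5"
  shows "1 / (1 - p\<^sup>2)\<^sup>2 + 1 / (1 + p) ^ 3 \<le> 2"
proof -
  have pos: "0 < (1 - p)\<^sup>2 * (1 + p) ^ 3"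
    using assms by simp
  have 1: "1 / (1 - p\<^sup>2)\<^sup>2 = (1 + p) / ((1 - p)\<^sup>2 * (1 + p) ^ 3)"
  proof -
    have "(1 - p)\<^sup>2 * (1 + p) ^ 3 = (1 + p) * (1 - p\<^sup>2)\<^sup>2"
      by algebra
    then show ?thesis
      using assms by simp
  qed
  have 2: "1 / (1 + p) ^ 3 = (1 - p)\<^sup>2 / ((1 - p)\<^sup>2 * (1 + p) ^ 3)"
    using assms by simp
  have "(1 + p) + (1 - p)\<^sup>2 \<le> 2 * ((1 - p)\<^sup>2 * (1 + p) ^ 3)"
  proof -
    have "2 * ((1 - p)\<^sup>2 * (1 + p) ^ 3) - ((1 + p) + (1 - p)\<^sup>2) =
        p * (3 - 5 * p - 4 * p * p) + 2 * p ^ 4 * (1 + p)"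
      by algebra
    \<comment> \<open>With \<open>p \<le> 2 / 5\<close> the bracket
      \<open>3 - 5 * p - 4 * p * p\<close> is at least 9/25.\<close>
    moreover have "p * p \<le> 2 / 5 * (2 / 5)"
      using assms by (intro mult_mono) auto
    then have "0 \<le> p * (3 - 5 * p - 4 * p * p)"
      using assms by (intro mult_nonneg_nonneg) auto
    moreover have "0 \<le> 2 * p ^ 4 * (1 + p)"
      using assms by simp
    ultimately show ?thesis by linarith
  qed
  then show ?thesis
    unfolding 1 2 add_divide_distrib[symmetric] using pos by (simp only: pos_divide_le_eq)
qed

text \<open>By Bernoulli's inequality the right side is at least \<open>8 / n + 8 * t\<close>.
  Either \<open>n \<le> 8\<close> suffices, or \<open>p \<ge> 2 / 5\<close> gives
  \<open>t \<ge> 8 / 45\<close>, which exceeds 1/8.\<close>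

lemma one_le_exponential_term:
  fixes p :: real
  assumes "0 \<le> p" "p < 1" "n \<ge> 1" "n \<le> 8 \<or> p \<ge> 2 / 5"
  shows "1 \<le> 8 / real n * (1 + p ^ 3 / (1 - p)\<^sup>2) ^ n"
proof -
  define t where "t = p ^ 3 / (1 - p)\<^sup>2"
  have "0 \<le> t"
    using assms by (simp add: t_def)
  have "real n \<le> 8 * (1 + real n * t)"
  proof (cases "p \<ge> 2 / 5")
    case True
    have "(2 / 5) ^ 3 / (3 / 5)\<^sup>2 \<le> t"
      unfolding t_def using True assms by (intro frac_le power_mono) auto
    then have "1 / 8 \<le> t"
      by (simp add: power2_eq_square power3_eq_cube)
    then have "real n * (1 / 8) \<le> real n * t"
      by (intro mult_left_mono) auto
    then show ?thesis by simp
  next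
    case False
    then have "real n \<le> 8"
      using assms by simp
    also have "8 \<le> 8 * (1 + real n * t)"
      using \<open>0 \<le> t\<close> by simp
    finally show ?thesis .
  qed
  also have "\<dots> \<le> 8 * (1 + t) ^ n"
    using Bernoulli_inequality[of t n] \<open>0 \<le> t\<close> by simp
  finally show ?thesis
    using assms by (simp add: t_def field_simps)
qed

section \<open>Assembling the upper bound\<close>

lemma upper_bound_from_second_moment:
  fixes P p :: real
  assumes p: "0 \<le> p" "p \<le> 2 / 5" and n: "n \<ge> 4"
  defines "q \<equiv> (1 - p) * (1 - p\<^sup>2) ^ (n - 2)"
    and "s \<equiv> (1 - p)\<^sup>2 * (1 - 2 * p\<^sup>2 + p ^ 3) ^ (n - 3)"
    and "d \<equiv> (1 - p) ^ 4 * (1 + 2 * p - p\<^sup>2) * (1 - p\<^sup>2) ^ (2 * (n - 4))"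
    and "K \<equiv> real n * (real n - 1) / 2"
  assumes P: "P * (K * q)\<^sup>2 \<le> K * (q + 2 * (real n - 1) * s + K * d) - (K * q)\<^sup>2"
  shows "P \<le> 2 / ((real n - 1)\<^sup>2 * (1 - p\<^sup>2) ^ n * (1 - p))
    + 8 / real n * (1 + p ^ 3 / (1 - p)\<^sup>2) ^ n"
proof -
  define t where "t = p ^ 3 / (1 - p)\<^sup>2"
  define a where "a = 1 / (1 - p\<^sup>2)\<^sup>2"
  define b where "b = 1 / (1 + p) ^ 3"
  have p2: "0 < 1 - p\<^sup>2" "1 - p\<^sup>2 \<le> 1" and "0 < 1 - p"
    using p by (auto simp: power_less_one_iff)
  have "0 < q" "0 < K" "0 \<le> t" "0 \<le> b"
    using p n p2 by (auto simp: q_def K_def t_def b_def)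
  have q2: "q\<^sup>2 = (1 - p)\<^sup>2 * (1 - p\<^sup>2) ^ (2 * (n - 2))"
    by (simp add: q_def power_mult_distrib power_mult[symmetric] mult.commute)
  have "s \<le> (1 - p)\<^sup>2 * ((1 - p\<^sup>2) ^ (2 * (n - 2)) * a * (1 + t) ^ n)"
    unfolding s_def a_def t_def
    using p n by (intro mult_left_mono adjacent_ratio_bound) auto
  then have s: "s \<le> q\<^sup>2 * (a * (1 + t) ^ n)"
    by (simp add: q2 mult_ac)
  have "d = (1 - p)\<^sup>2 * ((1 - p)\<^sup>2 * (1 + 2 * p - p\<^sup>2) * (1 - p\<^sup>2) ^ (2 * (n - 4)))"
    by (simp add: d_def power4_eq_xxxx power2_eq_square)
  also have "\<dots> \<le> (1 - p)\<^sup>2 * ((1 - p\<^sup>2) ^ (2 * (n - 2)) * (1 + 4 * t * b))"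
    unfolding t_def b_def using p n by (intro mult_left_mono disjoint_ratio_bound) auto
  finally have d: "d \<le> q\<^sup>2 * (1 + 4 * t * b)"
    by (simp add: q2 mult_ac)
  have "P * (K * q)\<^sup>2 \<le> K * (q + 2 * (real n - 1) * s + K * d) - (K * q)\<^sup>2"
    by (fact P)
  also have "\<dots> \<le> K * (q + 2 * (real n - 1) * (q\<^sup>2 * (a * (1 + t) ^ n))
      + K * (q\<^sup>2 * (1 + 4 * t * b))) - (K * q)\<^sup>2"
    using n \<open>0 < K\<close> s d by (intro diff_right_mono mult_left_mono add_mono order_refl) auto
  \<comment> \<open>The main part of the disjoint contribution cancels against the squared mean, so
    only the correction \<open>4 * t * b\<close> survives.\<close>
  also have "\<dots> = (1 / (K * q) + 2 * (real n - 1) / K * (a * (1 + t) ^ n) + 4 * t * b) * (K * q)\<^sup>2"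
    using \<open>0 < K\<close> \<open>0 < q\<close> by (simp add: field_simps power2_eq_square)
  finally have "P \<le> 1 / (K * q) + 2 * (real n - 1) / K * (a * (1 + t) ^ n) + 4 * t * b"
    using \<open>0 < K\<close> \<open>0 < q\<close> by (simp add: mult_le_cancel_right)
  also have "2 * (real n - 1) / K = 4 / real n"
    using n by (simp add: K_def field_simps)
  \<comment> \<open>The denominator shrinks when \<open>n * (n - 1)\<close> becomes
    \<open>(n - 1)\<^sup>2\<close> and the exponent \<open>n - 2\<close> becomes
    \<open>n\<close>.\<close>
  also have "1 / (K * q) \<le> 2 / ((real n - 1)\<^sup>2 * (1 - p\<^sup>2) ^ n * (1 - p))"
  proof -
    have "(real n - 1)\<^sup>2 * (1 - p\<^sup>2) ^ n * (1 - p) \<le>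
        (real n * (real n - 1)) * (1 - p\<^sup>2) ^ (n - 2) * (1 - p)"
      using p2 \<open>0 < 1 - p\<close> n
      by (intro mult_right_mono mult_mono power_decreasing)
        (auto simp: power2_eq_square)
    then have "2 / ((real n * (real n - 1)) * (1 - p\<^sup>2) ^ (n - 2) * (1 - p)) \<le>
        2 / ((real n - 1)\<^sup>2 * (1 - p\<^sup>2) ^ n * (1 - p))"
      using p2 \<open>0 < 1 - p\<close> n by (intro divide_left_mono) auto
    then show ?thesis
      by (simp add: K_def q_def mult_ac)
  qed
  \<comment> \<open>This term has no factor \<open>1 / n\<close>; Bernoulli's inequality in the form
    \<open>n * t \<le> (1 + t) ^ n\<close> supplies one.\<close>
  also have "4 * t * b \<le> 4 / real n * (b * (1 + t) ^ n)"
  proof -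
    have "real n * t \<le> (1 + t) ^ n"
      using Bernoulli_inequality[of t n] \<open>0 \<le> t\<close> by simp
    then have "4 / real n * (b * (real n * t)) \<le> 4 / real n * (b * (1 + t) ^ n)"
      using \<open>0 \<le> b\<close> by (intro mult_left_mono) auto
    then show ?thesis
      using n by (simp add: mult_ac)
  qed
  finally have "P \<le> 2 / ((real n - 1)\<^sup>2 * (1 - p\<^sup>2) ^ n * (1 - p))
      + 4 / real n * ((a + b) * (1 + t) ^ n)"
    by (simp add: algebra_simps)
  also have "4 / real n * ((a + b) * (1 + t) ^ n) \<le> 4 / real n * (2 * (1 + t) ^ n)"
    using coefficient_bound[OF p] \<open>0 \<le> t\<close>
    by (intro mult_left_mono mult_right_mono) (auto simp: a_def b_def)
  finally show ?thesis
    by (simp add: t_def)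
qed

text \<open>The guard \<open>p < 1\<close> keeps the denominators nonzero. At \<open>p = 1\<close>,
  with division by zero read as 0, the upper bound would be \<open>8 / n\<close>, which is false for
  \<open>n > 8\<close> because the graph is almost surely complete.\<close>

theorem theorem1p2:
  fixes n :: nat and p :: real
  assumes "n \<ge> 2" and "0 \<le> p" and "p \<le> 1"
  shows "prob_diameter_at_most_two n p \<ge> 1 - real n ^ 2 * (1 - p ^ 2) ^ (n - 2) * (1 - p) / 2 \<and>
    (p < 1 \<longrightarrow>
      prob_diameter_at_most_two n p
        \<le> 2 / ((real n - 1) ^ 2 * (1 - p ^ 2) ^ n * (1 - p))
          + 8 / real n * (1 + p ^ 3 / (1 - p) ^ 2) ^ n)"
proof (intro conjI impI)
  interpret edge_probability n p
    using assms by unfold_locales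
  show "prob_diameter_at_most_two n p \<ge> 1 - real n ^ 2 * (1 - p ^ 2) ^ (n - 2) * (1 - p) / 2"
    by (rule prob_diameter_at_most_two_ge)
  assume "p < 1"
  show "prob_diameter_at_most_two n p
      \<le> 2 / ((real n - 1) ^ 2 * (1 - p ^ 2) ^ n * (1 - p))
        + 8 / real n * (1 + p ^ 3 / (1 - p) ^ 2) ^ n"
  \<comment> \<open>In the first case the exponential term alone is at least 1, so the bound is
    trivial; the second moment is needed only for \<open>n > 8\<close> and
    \<open>p < 2 / 5\<close>.\<close>
  proof (cases "n \<le> 8 \<or> p \<ge> 2 / 5")
    case True
    have "prob_diameter_at_most_two n p \<le> 1"
      by (simp add: prob_diameter_at_most_two_def)
    also have "\<dots> \<le> 8 / real n * (1 + p ^ 3 / (1 - p) ^ 2) ^ n"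
      using assms \<open>p < 1\<close> True by (intro one_le_exponential_term) auto
    also have "\<dots> \<le> 2 / ((real n - 1) ^ 2 * (1 - p ^ 2) ^ n * (1 - p)) + \<dots>"
      using assms \<open>p < 1\<close> by (simp add: power_le_one)
    finally show ?thesis .
  next
    case False
    then show ?thesis
      using assms second_moment_estimate unfolding q_def s_def d_def
      by (intro upper_bound_from_second_moment) auto
  qed
qed

end
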